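(* Let $r \geqslant 2$ be an integer, let $p = p(n) \in (0,1)$ satisfy $p \gg n^{-2/(r+1)}$, and let $\varepsilon > 0$ be fixed. Then $$G\big((1+\varepsilon) rn, p\big) \to (K_{r+1}, P_n)$$ with high probability as $n \to \infty$.
   Context: $G(N,p)$ denotes the Erdős–Rényi random graph on $N$ vertices in which each pair is an edge independently with probability $p$. $P_n$ is the path with $n$ edges, and $K_{r+1}$ is the complete graph on $r+1$ vertices. For graphs $G, H_1, H_2$, we write $G \to (H_1,H_2)$ if every red-blue colouring of the edges of $G$ contains either a red copy of $H_1$ or a blue copy of $H_2$. For functions $f,g$, $f \gg g$ means $f/g \to \infty$ as $n \to \infty$. "With high probability" means with probability tending to $1$ as $n \to \infty$. *)

theory Defs
  imports "HOL-Probability.Probability" "HOL-Library.Ramsey"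
begin

text \<open>
  A simple graph is a vertex set together with a set of two-element vertex sets;
  \<^term>\<open>[V]\<^bsup>2\<^esup>\<close> is the set of all two-element subsets of \<^term>\<open>V\<close>.
\<close>

type_synonym 'a ugraph = "'a set \<times> 'a set set"

definition complete_ugraph :: "nat \<Rightarrow> nat ugraph" where
  "complete_ugraph m = ({..<m}, [{..<m}]\<^bsup>2\<^esup>)"

text \<open>The path is indexed by its number of edges, so it has \<^term>\<open>n + 1\<close> vertices.\<close>

definition path_ugraph :: "nat \<Rightarrow> nat ugraph" where
  "path_ugraph n = ({..n}, {{i, Suc i} | i. i < n})"

text \<open>Copies are subgraphs that need not be induced.\<close>

definition contains_copy :: "'a ugraph \<Rightarrow> 'b ugraph \<Rightarrow> bool" where
  "contains_copy G H \<longleftrightarrow>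
     (\<exists>f. inj_on f (fst H) \<and> f ` fst H \<subseteq> fst G \<and> (\<forall>e\<in>snd H. f ` e \<in> snd G))"

text \<open>The sets \<^term>\<open>R\<close> and \<^term>\<open>B\<close> are the red and the blue edges.\<close>

definition ramsey_arrow :: "'a ugraph \<Rightarrow> 'b ugraph \<Rightarrow> 'c ugraph \<Rightarrow> bool" where
  "ramsey_arrow G H\<^sub>1 H\<^sub>2 \<longleftrightarrow>
     (\<forall>R B. R \<union> B = snd G \<and> R \<inter> B = {} \<longrightarrow>
        contains_copy (fst G, R) H\<^sub>1 \<or> contains_copy (fst G, B) H\<^sub>2)"

definition erdos_renyi :: "nat \<Rightarrow> real \<Rightarrow> nat ugraph pmf" where
  "erdos_renyi N p =
     map_pmf (\<lambda>X. ({..<N}, {e \<in> [{..<N}]\<^bsup>2\<^esup>. X e}))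
       (Pi_pmf ([{..<N}]\<^bsup>2\<^esup>) False (\<lambda>_. bernoulli_pmf p))"

end

theory Submission
  imports Defs "HOL-Real_Asymp.Real_Asymp"
begin

text \<open>
  If the blue graph has no path with n edges, then the stack of a depth-first search never holds
  more than n vertices. Stopping the search when k vertices are finished leaves a set of at least
  |V| - n - k unvisited vertices without blue edges to the finished ones; iterating inside this set
  gives r + 1 disjoint sets of size k, linear in n, between which every edge is red. It remains to
  see that with high probability every such family of sets has a transversal clique in the random
  graph. For one family, Janson's inequality bounds the probability of failure by
  exp (- K n), with K arbitrarily large because p is much larger than n powr (- 2 / (r + 1)); this
  beats the at most 2 ^ (N (r + 1)) choices of the family.
\<close>

subsection \<open>Blue graphs without long paths\<close>

text \<open>
  The triple (S, xs, T) is a state of depth-first search: S holds the finished vertices, xs is the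
  stack and T holds the vertices not yet visited. Since S grows by one vertex at a time, the search
  can be stopped when S has any prescribed size.
\<close>

lemma depth_first_search_state:
  assumes "finite V" "k \<le> card V"
  shows "\<exists>S xs T. S \<union> set xs \<union> T = V \<and> S \<inter> set xs = {} \<and> S \<inter> T = {} \<and> set xs \<inter> T = {} \<and>
    distinct xs \<and> successively (\<lambda>x y. {x, y} \<in> B) xs \<and> card S = k \<and>
    (\<forall>s\<in>S. \<forall>t\<in>T. {s, t} \<notin> B)"
  using assms(2)
proof (induction k)
  case 0
  show ?case by (rule exI[of _ "{}"], rule exI[of _ "[]"], rule exI[of _ V]) simp
next
  case (Suc k)
  define state where "state S xs T \<longleftrightarrow>
    S \<union> set xs \<union> T = V \<and> S \<inter> set xs = {} \<and> S \<inter> T = {} \<and> set xs \<inter> T = {} \<and>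
    distinct xs \<and> successively (\<lambda>x y. {x, y} \<in> B) xs \<and> (\<forall>s\<in>S. \<forall>t\<in>T. {s, t} \<notin> B)" for S xs T
  \<comment> \<open>With \<open>S\<close> fixed, every push shrinks \<open>T\<close>, so the search
    must eventually pop; the popped vertex becomes the next element of \<open>S\<close>.\<close>
  have step: "\<exists>S xs T. state S xs T \<and> card S = Suc k" if "state S xs T" "card S = k" for S xs T
    using that
  proof (induction "card T" arbitrary: xs T rule: less_induct)
    case less
    have fin: "finite S" "finite T"
      using less.prems assms(1) by (auto simp: state_def intro: finite_subset)
    have push: ?case if "t \<in> T" "xs = [] \<or> {t, hd xs} \<in> B" for t
    proof (rule less.hyps[of "T - {t}" "t # xs"])
      show "card (T - {t}) < card T"
        using fin that by (meson card_Diff1_less)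
      show "state S (t # xs) (T - {t})"
        using less.prems(1) that unfolding state_def by (auto simp: successively_Cons)
    qed (rule less.prems)
    show ?case
    proof (cases xs)
      case Nil
      \<comment> \<open>With an empty stack only the \<open>k\<close> vertices of \<open>S\<close>
        have been visited, and \<open>k < card V\<close>.\<close>
      have "T \<noteq> {}"
        using less.prems Suc.prems Nil by (auto simp: state_def)
      with Nil push show ?thesis by blast
    next
      case (Cons x ys)
      show ?thesis
      proof (cases "\<exists>t\<in>T. {t, x} \<in> B")
        case True
        with Cons push show ?thesis by auto
      next
        case False
        \<comment> \<open>The stack top \<open>x\<close> has no blue edge into \<open>T\<close>, so
          moving it to \<open>S\<close> keeps the invariant.\<close>
        then have "state (insert x S) ys T"
          using less.prems(1) Cons unfolding state_def
          by (auto simp: successively_Cons insert_commute)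
        moreover have "card (insert x S) = Suc k"
          using less.prems Cons fin by (auto simp: state_def)
        ultimately show ?thesis by blast
      qed
    qed
  qed
  obtain S xs T where "state S xs T" "card S = k"
    using Suc unfolding state_def by (meson Suc_leD)
  from step[OF this] show ?case
    unfolding state_def by metis
qed

text \<open>The stack is a blue path, hence has at most \<open>n\<close> vertices. Each of the
  \<open>r\<close> rounds of the search spends \<open>k\<close> finished vertices and at most
  \<open>n\<close> on the stack, and the last set costs only \<open>k\<close> more; this is the
  budget in the bound on \<open>card V\<close>.\<close>

lemma disconnected_sets_if_no_path:
  assumes "finite V"
    and "\<And>xs. distinct xs \<Longrightarrow> set xs \<subseteq> V \<Longrightarrow> successively (\<lambda>x y. {x, y} \<in> B) xs \<Longrightarrow> length xs \<le> n"
    and "r * (n + k) + k \<le> card V"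
  shows "\<exists>A. (\<forall>i\<le>r. A i \<subseteq> V \<and> card (A i) = k) \<and>
    (\<forall>i\<le>r. \<forall>j\<le>r. i \<noteq> j \<longrightarrow> A i \<inter> A j = {} \<and> (\<forall>x\<in>A i. \<forall>y\<in>A j. {x, y} \<notin> B))"
  using assms
proof (induction r arbitrary: V)
  case 0
  then obtain S where "S \<subseteq> V" "card S = k"
    by (metis add_0 mult_0 obtain_subset_with_card_n)
  then show ?case by (intro exI[of _ "\<lambda>_. S"]) simp
next
  case (Suc r)
  obtain S xs T where
    S: "S \<union> set xs \<union> T = V" "S \<inter> set xs = {}" "S \<inter> T = {}" "set xs \<inter> T = {}"
    "distinct xs" "successively (\<lambda>x y. {x, y} \<in> B) xs" "card S = k" "\<forall>s\<in>S. \<forall>t\<in>T. {s, t} \<notin> B"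
    using depth_first_search_state[of V k B] Suc.prems by auto
  have fin: "finite S" "finite T" using S(1) Suc.prems(1) by auto
  have "card (S \<union> set xs \<union> T) = card S + length xs + card T"
    using S(2-5) fin by (simp add: card_Un_disjoint Int_Un_distrib2 distinct_card)
  moreover have "length xs \<le> n"
    using S by (intro Suc.prems(2)) auto
  ultimately have "r * (n + k) + k \<le> card T"
    using Suc.prems(3) S(1,7) by simp
  moreover have "length ys \<le> n"
    if "distinct ys" "set ys \<subseteq> T" "successively (\<lambda>x y. {x, y} \<in> B) ys" for ys
    using that S(1) by (intro Suc.prems(2)) auto
  ultimately obtain A where A: "\<forall>i\<le>r. A i \<subseteq> T \<and> card (A i) = k"
    "\<forall>i\<le>r. \<forall>j\<le>r. i \<noteq> j \<longrightarrow> A i \<inter> A j = {} \<and> (\<forall>x\<in>A i. \<forall>y\<in>A j. {x, y} \<notin> B)"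
    using Suc.IH[of T] fin by blast
  \<comment> \<open>Sets found inside \<open>T\<close> inherit disjointness from \<open>S\<close>
    and the lack of blue edges to it. Both orders of a pair are recorded because \<open>S\<close>
    may come first or second below.\<close>
  have *: "A i \<inter> S = {} \<and> (\<forall>x\<in>A i. \<forall>y\<in>S. {x, y} \<notin> B \<and> {y, x} \<notin> B)" if "i \<le> r" for i
    using A(1) S(3,8) that by (metis Int_commute disjoint_iff insert_commute subset_iff)
  show ?case
  proof (intro exI[of _ "A(Suc r := S)"] conjI allI impI)
    fix i j assume "i \<le> Suc r" "j \<le> Suc r" "i \<noteq> j"
    then consider "i = Suc r" "j \<le> r" | "j = Suc r" "i \<le> r" | "i \<le> r" "j \<le> r"
      by linarith
    then show "(A(Suc r := S)) i \<inter> (A(Suc r := S)) j = {}"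
      using A(2) *[of i] *[of j] \<open>i \<noteq> j\<close> by cases (simp_all add: Int_commute)
    show "\<forall>x\<in>(A(Suc r := S)) i. \<forall>y\<in>(A(Suc r := S)) j. {x, y} \<notin> B"
      using A(2) *[of i] *[of j] \<open>i \<le> Suc r\<close> \<open>j \<le> Suc r\<close> \<open>i \<noteq> j\<close>
      by (auto simp: le_Suc_eq)
  qed (use A(1) S(1,7) in \<open>auto simp: le_Suc_eq\<close>)
qed

text \<open>A path with \<open>n\<close> edges needs \<open>n + 1\<close> vertices, so a longer list
  serves through its first \<open>n + 1\<close> entries.\<close>

lemma contains_copy_path_ugraphI:
  assumes "distinct xs" "set xs \<subseteq> V" "successively (\<lambda>x y. {x, y} \<in> B) xs" "n < length xs"
  shows "contains_copy (V, B) (path_ugraph n)"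
proof -
  have "{xs ! i, xs ! Suc i} \<in> B" if "i < n" for i
  proof -
    have "Suc i < length xs" using that assms(4) by simp
    with assms(3) show ?thesis
    proof (induction xs arbitrary: i)
      case (Cons x xs)
      then show ?case by (cases i; cases xs) auto
    qed simp
  qed
  then show ?thesis
    unfolding contains_copy_def path_ugraph_def using assms
    by (intro exI[of _ "\<lambda>i. xs ! i"]) (auto simp: inj_on_def nth_eq_iff_index_eq)
qed

text \<open>Isolates what randomness must supply. All edges of a transversal clique run between
  different sets, so when the sets have no blue edges between them the clique is red.\<close>

lemma ramsey_arrow_if_transversal_cliques:
  assumes "finite V" "r * (n + k) + k \<le> card V"
    and clique: "\<And>A. (\<And>i. i \<le> r \<Longrightarrow> A i \<subseteq> V \<and> card (A i) = k) \<Longrightarrow>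
      (\<And>i j. i \<le> r \<Longrightarrow> j \<le> r \<Longrightarrow> i \<noteq> j \<Longrightarrow> A i \<inter> A j = {}) \<Longrightarrow>
      \<exists>v\<in>Pi\<^sub>E {..r} A. [v ` {..r}]\<^bsup>2\<^esup> \<subseteq> E"
  shows "ramsey_arrow (V, E) (complete_ugraph (r + 1)) (path_ugraph n)"
  unfolding ramsey_arrow_def fst_conv snd_conv
proof (intro allI impI disjCI)
  fix R B assume RB: "R \<union> B = E \<and> R \<inter> B = {}" and no_path: "\<not> contains_copy (V, B) (path_ugraph n)"
  obtain A where A: "\<forall>i\<le>r. A i \<subseteq> V \<and> card (A i) = k"
    "\<forall>i\<le>r. \<forall>j\<le>r. i \<noteq> j \<longrightarrow> A i \<inter> A j = {} \<and> (\<forall>x\<in>A i. \<forall>y\<in>A j. {x, y} \<notin> B)"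
    using disconnected_sets_if_no_path[OF assms(1) _ assms(2), of B] no_path
    by (metis contains_copy_path_ugraphI not_le)
  then obtain v where v: "v \<in> Pi\<^sub>E {..r} A" "[v ` {..r}]\<^bsup>2\<^esup> \<subseteq> E"
    using clique[of A] by auto
  have inj: "inj_on v {..r}"
    using v(1) A(2) by (intro inj_onI) (metis PiE_mem atMost_iff disjoint_iff)
  have "{v i, v j} \<in> R" if "i \<le> r" "j \<le> r" "i \<noteq> j" for i j
  proof -
    have "{v i, v j} \<in> E"
      using v(2) that inj by (auto simp: inj_on_def intro!: subsetD[OF v(2)])
    moreover have "{v i, v j} \<notin> B"
      using A(2) v(1) that by (auto simp: PiE_iff)
    ultimately show ?thesis using RB by blast
  qed
  moreover have "v ` {..r} \<subseteq> V"
    using v(1) A(1) by (fastforce simp: PiE_iff)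
  ultimately show "contains_copy (V, R) (complete_ugraph (r + 1))"
    unfolding contains_copy_def complete_ugraph_def using inj
    by (intro exI[of _ v]) (auto simp: lessThan_Suc_atMost nsets_2_eq)
qed

subsection \<open>Correlation inequalities for product Bernoulli measures\<close>

abbreviation bernoulli_product :: "'e set \<Rightarrow> real \<Rightarrow> ('e \<Rightarrow> bool) pmf" where
  "bernoulli_product E p \<equiv> Pi_pmf E False (\<lambda>_. bernoulli_pmf p)"

lemma finite_set_bernoulli_product:
  assumes "finite E"
  shows "finite (set_pmf (bernoulli_product E p))"
proof (rule finite_subset)
  show "set_pmf (bernoulli_product E p) \<subseteq> PiE_dflt E False (\<lambda>_. UNIV)"
    using set_Pi_pmf_subset[OF assms, of False "\<lambda>_. bernoulli_pmf p"] by (auto simp: PiE_dflt_def)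
  show "finite (PiE_dflt E False (\<lambda>_. UNIV :: bool set))"
    using assms by (intro finite_PiE_dflt) auto
qed

lemma integrable_bernoulli_product:
  fixes f :: "('e \<Rightarrow> bool) \<Rightarrow> real"
  assumes "finite E"
  shows "integrable (measure_pmf (bernoulli_product E p)) f"
  using finite_set_bernoulli_product[OF assms] by (rule integrable_measure_pmf_finite)

text \<open>Conditioning on the coordinate \<open>e\<close>; the inductions below peel off one
  coordinate at a time in this way.\<close>

lemma expectation_bernoulli_product_insert:
  fixes f :: "('e \<Rightarrow> bool) \<Rightarrow> real"
  assumes "finite E" "e \<notin> E" "0 \<le> p" "p \<le> 1"
  shows "measure_pmf.expectation (bernoulli_product (insert e E) p) f =
    p * measure_pmf.expectation (bernoulli_product E p) (\<lambda>X. f (X(e := True))) +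
    (1 - p) * measure_pmf.expectation (bernoulli_product E p) (\<lambda>X. f (X(e := False)))"
proof -
  have "bernoulli_product (insert e E) p =
    bind_pmf (bernoulli_pmf p) (\<lambda>b. map_pmf (\<lambda>X. X(e := b)) (bernoulli_product E p))"
    using assms by (simp add: Pi_pmf_insert' map_pmf_def)
  then have "measure_pmf.expectation (bernoulli_product (insert e E) p) f =
    (\<Sum>b\<in>UNIV. pmf (bernoulli_pmf p) b *
       measure_pmf.expectation (map_pmf (\<lambda>X. X(e := b)) (bernoulli_product E p)) f)"
    using pmf_expectation_bind[of UNIV "\<lambda>b. map_pmf (\<lambda>X. X(e := b)) (bernoulli_product E p)"
        "bernoulli_pmf p" f] finite_set_bernoulli_product[OF assms(1)]
    by simp
  then show ?thesis
    using assms(3,4) by (simp add: UNIV_bool)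
qed

lemma expectation_bernoulli_product_mono:
  fixes f g :: "('e \<Rightarrow> bool) \<Rightarrow> real"
  assumes "finite E" "\<And>X. f X \<le> g X"
  shows "measure_pmf.expectation (bernoulli_product E p) f
    \<le> measure_pmf.expectation (bernoulli_product E p) g"
  using assms by (intro integral_mono integrable_bernoulli_product) auto

lemma antimono_fun_upd:
  fixes f :: "('e \<Rightarrow> bool) \<Rightarrow> real"
  assumes "antimono f"
  shows "antimono (\<lambda>X. f (X(e := b)))" "f (X(e := True)) \<le> f (X(e := False))"
  using assms by (auto intro!: antimonoI elim!: antimonoD simp: le_fun_def)

text \<open>Induction over the coordinates: the induction hypothesis treats both values of
  \<open>e\<close>, and a two-point Chebyshev inequality combines them.\<close>

lemma harris_inequality:
  fixes f g :: "('e \<Rightarrow> bool) \<Rightarrow> real"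
  assumes "finite E" "0 \<le> p" "p \<le> 1" "antimono f" "antimono g"
  shows "measure_pmf.expectation (bernoulli_product E p) f * measure_pmf.expectation (bernoulli_product E p) g
    \<le> measure_pmf.expectation (bernoulli_product E p) (\<lambda>X. f X * g X)"
  using assms(1,4,5)
proof (induction E arbitrary: f g rule: finite_induct)
  case empty
  then show ?case by simp
next
  case (insert e E)
  let ?M = "bernoulli_product E p"
  define a where "a b = measure_pmf.expectation ?M (\<lambda>X. f (X(e := b)))" for b
  define c where "c b = measure_pmf.expectation ?M (\<lambda>X. g (X(e := b)))" for b
  define d where "d b = measure_pmf.expectation ?M (\<lambda>X. f (X(e := b)) * g (X(e := b)))" for b
  have d: "a b * c b \<le> d b" for b
    unfolding a_def c_def d_def using insert.prems by (intro insert.IH antimono_fun_upd)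
  have "a True \<le> a False" "c True \<le> c False"
    unfolding a_def c_def using insert.hyps insert.prems
    by (auto intro!: expectation_bernoulli_product_mono antimono_fun_upd)
  \<comment> \<open>This product is the covariance of the two conditional means, viewed as functions
    of the coordinate \<open>e\<close>.\<close>
  then have "0 \<le> p * (1 - p) * ((a False - a True) * (c False - c True))"
    using assms(2,3) by simp
  then have "(p * a True + (1 - p) * a False) * (p * c True + (1 - p) * c False)
    \<le> p * (a True * c True) + (1 - p) * (a False * c False)"
    by (simp add: algebra_simps)
  also have "\<dots> \<le> p * d True + (1 - p) * d False"
    using assms(2,3) d by (intro add_mono mult_left_mono) auto
  finally show ?case
    using insert.hyps assms(2,3)
    by (simp add: expectation_bernoulli_product_insert a_def c_def d_def)
qed

text \<open>Takes the place of a monotone coupling. The induction hypothesis changes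
  \<open>q\<close> to \<open>p\<close> on the other coordinates; reweighting \<open>e\<close> then
  changes the mean by \<open>q - p\<close> times a nonnegative difference.\<close>

lemma expectation_bernoulli_product_antimono:
  fixes f :: "('e \<Rightarrow> bool) \<Rightarrow> real"
  assumes "finite E" "0 \<le> p" "p \<le> q" "q \<le> 1" "antimono f"
  shows "measure_pmf.expectation (bernoulli_product E q) f
    \<le> measure_pmf.expectation (bernoulli_product E p) f"
  using assms(1,5)
proof (induction E arbitrary: f rule: finite_induct)
  case empty
  then show ?case by simp
next
  case (insert e E)
  define a where "a q b = measure_pmf.expectation (bernoulli_product E q) (\<lambda>X. f (X(e := b)))" for q b
  have a: "a q b \<le> a p b" for b
    unfolding a_def using insert.prems by (intro insert.IH antimono_fun_upd)
  have "a p True \<le> a p False"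
    unfolding a_def using insert.hyps insert.prems
    by (auto intro!: expectation_bernoulli_product_mono antimono_fun_upd)
  then have "0 \<le> (q - p) * (a p False - a p True)"
    using assms(3) by simp
  moreover have "q * a q True + (1 - q) * a q False \<le> q * a p True + (1 - q) * a p False"
    using assms a by (intro add_mono mult_left_mono) auto
  ultimately have "q * a q True + (1 - q) * a q False \<le> p * a p True + (1 - p) * a p False"
    by (simp add: algebra_simps)
  then show ?case
    using insert.hyps assms by (simp add: expectation_bernoulli_product_insert a_def)
qed

text \<open>By independence, conditioning on \<open>S\<close> being present just forces those
  coordinates to be true. For Janson's inequality this yields equality when \<open>g\<close> ignores
  \<open>S\<close>, and an upper bound when \<open>g\<close> is antimonotone.\<close>

lemma expectation_bernoulli_product_all_True:
  fixes g :: "('e \<Rightarrow> bool) \<Rightarrow> real"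
  assumes "finite E" "S \<subseteq> E" "0 \<le> p" "p \<le> 1"
  shows "measure_pmf.expectation (bernoulli_product E p) (\<lambda>X. of_bool (\<forall>e\<in>S. X e) * g X)
    = p ^ card S * measure_pmf.expectation (bernoulli_product E p) (\<lambda>X. g (\<lambda>e. e \<in> S \<or> X e))"
proof -
  have "finite S" using assms finite_subset by auto
  then show ?thesis using assms(2)
  proof (induction S arbitrary: g rule: finite_induct)
    case empty
    then show ?case by simp
  next
    case (insert e S)
    let ?E = "\<lambda>f. measure_pmf.expectation (bernoulli_product E p) f :: real"
    have single: "?E (\<lambda>X. of_bool (X e) * h X) = p * ?E (\<lambda>X. h (X(e := True)))"
      for h :: "('e \<Rightarrow> bool) \<Rightarrow> real"
    proof -
      have E: "E = insert e (E - {e})" "finite (E - {e})" "e \<notin> E - {e}"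
        using insert.prems assms(1) by auto
      show ?thesis
        by (subst (1 2) E(1), subst (1 2) expectation_bernoulli_product_insert[OF E(2,3) assms(3,4)])
          (simp add: algebra_simps)
    qed
    have "?E (\<lambda>X. of_bool (\<forall>e\<in>insert e S. X e) * g X)
        = ?E (\<lambda>X. of_bool (\<forall>e\<in>S. X e) * (of_bool (X e) * g X))"
      by (rule Bochner_Integration.integral_cong) auto
    also have "\<dots> = p ^ card S * ?E (\<lambda>X. of_bool (e \<in> S \<or> X e) * g (\<lambda>e. e \<in> S \<or> X e))"
      using insert by simp
    also have "?E (\<lambda>X. of_bool (e \<in> S \<or> X e) * g (\<lambda>e. e \<in> S \<or> X e))
        = ?E (\<lambda>X. of_bool (X e) * g (\<lambda>e. e \<in> S \<or> X e))"
      using insert.hyps by simp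
    also have "\<dots> = p * ?E (\<lambda>X. g (\<lambda>x. x \<in> S \<or> (X(e := True)) x))"
      by (rule single)
    also have "(\<lambda>X. g (\<lambda>x. x \<in> S \<or> (X(e := True)) x)) = (\<lambda>X. g (\<lambda>x. x \<in> insert e S \<or> X x))"
      by (intro ext arg_cong[of _ _ g]) auto
    finally show ?case
      using insert.hyps by simp
  qed
qed

text \<open>The events are added one at a time. Given that none of the earlier ones occurs, the new
  one has conditional probability at least \<open>b\<close>, so avoiding it costs a factor of at
  most \<open>1 - b\<close>, which is at most \<open>exp (- b)\<close>. The correlation sum runs
  over ordered pairs, so each overlap counts twice.\<close>

lemma janson_inequality:
  fixes F :: "'i \<Rightarrow> 'e set"
  assumes "finite E" "0 \<le> p" "p \<le> 1" "finite I" "\<And>i. i \<in> I \<Longrightarrow> F i \<subseteq> E"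
  shows "measure_pmf.expectation (bernoulli_product E p) (\<lambda>X. of_bool (\<forall>i\<in>I. \<not> (\<forall>e\<in>F i. X e)))
    \<le> exp (- (\<Sum>i\<in>I. p ^ card (F i))
        + (\<Sum>i\<in>I. \<Sum>j\<in>{j \<in> I. j \<noteq> i \<and> F i \<inter> F j \<noteq> {}}. p ^ card (F i \<union> F j)))"
  using assms(4,5)
proof (induction I rule: finite_induct)
  case empty
  then show ?case by simp
next
  case (insert i I)
  let ?E = "\<lambda>f. measure_pmf.expectation (bernoulli_product E p) f :: real"
  define B where "B j X \<longleftrightarrow> (\<forall>e\<in>F j. X e)" for j X
  define D where "D J X \<longleftrightarrow> (\<forall>j\<in>J. \<not> B j X)" for J X
  define J0 where "J0 = {j \<in> I. F i \<inter> F j = {}}"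
  define J1 where "J1 = {j \<in> I. F i \<inter> F j \<noteq> {}}"
  \<comment> \<open>Probability of the new event minus its joint probabilities with the dependent
    earlier events; it may be negative.\<close>
  define b where "b = p ^ card (F i) - (\<Sum>j\<in>J1. p ^ card (F i \<union> F j))"
  note int = integrable_bernoulli_product[OF assms(1)]
  have fin: "finite J1" "finite I" using insert by (auto simp: J1_def)
  have Fi: "F i \<subseteq> E" using insert by auto
  have F: "F i \<union> F j \<subseteq> E" if "j \<in> J1" for j using insert that by (auto simp: J1_def)
  have anti: "antimono (\<lambda>X. of_bool (D J X) :: real)" for J
    unfolding D_def B_def by (intro antimonoI) (force simp: le_fun_def)
  have nonneg: "0 \<le> ?E (\<lambda>X. of_bool (P X))" for P :: "('e \<Rightarrow> bool) \<Rightarrow> bool"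
    by (intro integral_nonneg_AE) auto
  \<comment> \<open>The events in \<open>J0\<close> do not involve the coordinates in
    \<open>F i\<close>.\<close>
  have indep: "?E (\<lambda>X. of_bool (B i X) * of_bool (D J0 X)) = p ^ card (F i) * ?E (\<lambda>X. of_bool (D J0 X))"
  proof -
    have "D J0 (\<lambda>e. e \<in> F i \<or> X e) = D J0 X" for X
      unfolding D_def B_def J0_def by blast
    then show ?thesis
      unfolding B_def using expectation_bernoulli_product_all_True[OF assms(1) Fi assms(2,3), of "\<lambda>X. of_bool (D J0 X)"]
      by simp
  qed
  \<comment> \<open>Forcing coordinates to be true can only destroy the antimonotone event
    \<open>D J0\<close>.\<close>
  have neg: "?E (\<lambda>X. of_bool (B i X \<and> B j X) * of_bool (D J0 X))
      \<le> p ^ card (F i \<union> F j) * ?E (\<lambda>X. of_bool (D J0 X))" if "j \<in> J1" for j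
  proof -
    have eq: "(B i X \<and> B j X) = (\<forall>e\<in>F i \<union> F j. X e)" for X by (auto simp: B_def)
    have "?E (\<lambda>X. of_bool (B i X \<and> B j X) * of_bool (D J0 X))
      = p ^ card (F i \<union> F j) * ?E (\<lambda>X. of_bool (D J0 (\<lambda>e. e \<in> F i \<union> F j \<or> X e)))"
      unfolding eq using F[OF that] assms by (intro expectation_bernoulli_product_all_True) auto
    also have "\<dots> \<le> p ^ card (F i \<union> F j) * ?E (\<lambda>X. of_bool (D J0 X))"
      using assms by (intro mult_left_mono expectation_bernoulli_product_mono antimonoD[OF anti])
        (auto simp: le_fun_def)
    finally show ?thesis .
  qed
  have "b * ?E (\<lambda>X. of_bool (D J0 X))
      \<le> ?E (\<lambda>X. of_bool (B i X) * of_bool (D J0 X))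
        - (\<Sum>j\<in>J1. ?E (\<lambda>X. of_bool (B i X \<and> B j X) * of_bool (D J0 X)))"
    unfolding b_def left_diff_distrib indep sum_distrib_right using neg by (simp add: sum_mono)
  also have "\<dots> = ?E (\<lambda>X. of_bool (B i X) * of_bool (D J0 X)
        - (\<Sum>j\<in>J1. of_bool (B i X \<and> B j X) * of_bool (D J0 X)))"
    by (simp add: Bochner_Integration.integral_diff Bochner_Integration.integral_sum int)
  also have "\<dots> \<le> ?E (\<lambda>X. of_bool (B i X \<and> D I X))"
  proof (intro expectation_bernoulli_product_mono assms)
    fix X
    show "of_bool (B i X) * of_bool (D J0 X) - (\<Sum>j\<in>J1. of_bool (B i X \<and> B j X) * of_bool (D J0 X))
      \<le> (of_bool (B i X \<and> D I X) :: real)"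
    \<comment> \<open>In the critical case \<open>B i\<close> occurs and \<open>D J0\<close> holds,
      but some earlier event occurs. That event has its index in \<open>J1\<close>, so the
      subtracted sum is at least 1.\<close>
    proof (cases "B i X \<and> D J0 X \<and> \<not> D I X")
      case True
      then obtain j where "j \<in> J1" "B j X"
        unfolding D_def J0_def J1_def by blast
      then have "1 \<le> (\<Sum>j\<in>J1. of_bool (B i X \<and> B j X) * of_bool (D J0 X) :: real)"
        using True fin by (intro order_trans[OF _ member_le_sum[of j]]) auto
      then show ?thesis using True by simp
    next
      case False
      then show ?thesis by (auto intro!: sum_nonneg)
    qed
  qed
  finally have *: "b * ?E (\<lambda>X. of_bool (D J0 X)) \<le> ?E (\<lambda>X. of_bool (B i X \<and> D I X))" .
  \<comment> \<open>For \<open>b\<close> nonnegative, \<open>D I\<close> implies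
    \<open>D J0\<close>; for \<open>b\<close> negative, the left side is at most 0.\<close>
  have "b * ?E (\<lambda>X. of_bool (D I X)) \<le> ?E (\<lambda>X. of_bool (B i X \<and> D I X))"
  proof (cases "b \<ge> 0")
    case True
    have "?E (\<lambda>X. of_bool (D I X)) \<le> ?E (\<lambda>X. of_bool (D J0 X))"
      by (intro expectation_bernoulli_product_mono assms) (auto simp: D_def J0_def)
    with True * show ?thesis by (meson mult_left_mono order_trans)
  next
    case False
    then show ?thesis
      using nonneg by (meson mult_nonpos_nonneg nle_le order_trans)
  qed
  moreover have "?E (\<lambda>X. of_bool (D (insert i I) X))
      = ?E (\<lambda>X. of_bool (D I X)) - ?E (\<lambda>X. of_bool (B i X \<and> D I X))"
    by (subst Bochner_Integration.integral_diff[symmetric])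
      (auto intro!: int Bochner_Integration.integral_cong simp: D_def)
  ultimately have "?E (\<lambda>X. of_bool (D (insert i I) X)) \<le> (1 + (- b)) * ?E (\<lambda>X. of_bool (D I X))"
    by (simp add: algebra_simps)
  also have "\<dots> \<le> exp (- b) * ?E (\<lambda>X. of_bool (D I X))"
    by (intro mult_right_mono exp_ge_add_one_self nonneg)
  also have "\<dots> \<le> exp (- b) * exp (- (\<Sum>i\<in>I. p ^ card (F i))
        + (\<Sum>i\<in>I. \<Sum>j\<in>{j \<in> I. j \<noteq> i \<and> F i \<inter> F j \<noteq> {}}. p ^ card (F i \<union> F j)))"
    using insert unfolding D_def B_def by (intro mult_left_mono) auto
  also have "\<dots> \<le> exp (- (\<Sum>i\<in>insert i I. p ^ card (F i))
        + (\<Sum>k\<in>insert i I. \<Sum>j\<in>{j \<in> insert i I. j \<noteq> k \<and> F k \<inter> F j \<noteq> {}}. p ^ card (F k \<union> F j)))"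
  proof -
    have "{j \<in> insert i I. j \<noteq> i \<and> F i \<inter> F j \<noteq> {}} = J1"
      using insert by (auto simp: J1_def)
    \<comment> \<open>The new row of the double sum is already in \<open>b\<close>; the new column
      is nonnegative and is simply added.\<close>
    moreover have "(\<Sum>k\<in>I. \<Sum>j\<in>{j \<in> I. j \<noteq> k \<and> F k \<inter> F j \<noteq> {}}. p ^ card (F k \<union> F j))
      \<le> (\<Sum>k\<in>I. \<Sum>j\<in>{j \<in> insert i I. j \<noteq> k \<and> F k \<inter> F j \<noteq> {}}. p ^ card (F k \<union> F j))"
      using fin assms(2) by (intro sum_mono sum_mono2) auto
    ultimately show ?thesis
      using insert by (simp add: b_def flip: exp_add)
  qed
  finally show ?case
    unfolding D_def B_def .
qed

subsection \<open>Transversal cliques\<close>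

lemma two_mult_choose_two: "2 * (n choose 2) = n * (n - 1)"
proof -
  have "even (n * (n - 1))" by (cases n) auto
  then show ?thesis by (simp add: choose_two)
qed

text \<open>
  The edge probability is written as s^2 so that half-integral powers of it become natural powers
  of s. The smallness hypothesis makes the correlation term of Janson's inequality at most half of
  the expected number of transversal cliques; it forces s^2 to be close to the threshold, and larger
  probabilities are reached by monotonicity.
\<close>

lemma transversal_clique_missing_bound:
  fixes A :: "nat \<Rightarrow> 'a set" and s :: real
  assumes "finite V" and A: "\<And>i. i \<le> r \<Longrightarrow> A i \<subseteq> V \<and> card (A i) = k"
    and disj: "\<And>i j. i \<le> r \<Longrightarrow> j \<le> r \<Longrightarrow> i \<noteq> j \<Longrightarrow> A i \<inter> A j = {}"
    and s: "0 \<le> s" "s \<le> 1" and small: "2 ^ (r + 1) * (real k * s ^ (r + 2)) \<le> 1 / 2"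
  shows "measure_pmf.expectation (bernoulli_product ([V]\<^bsup>2\<^esup>) (s\<^sup>2))
      (\<lambda>X. of_bool (\<forall>v\<in>Pi\<^sub>E {..r} A. \<not> (\<forall>e\<in>[v ` {..r}]\<^bsup>2\<^esup>. X e)))
    \<le> exp (- (real k * (real k * s ^ (r + 1)) ^ r) / 2)"
proof -
  define I where "I = Pi\<^sub>E {..r} A"
  define F where "F v = [v ` {..r}]\<^bsup>2\<^esup>" for v :: "nat \<Rightarrow> 'a"
  define b where "b = real k * s ^ (r + 2)"
  define \<mu> where "\<mu> = (\<Sum>v\<in>I. (s\<^sup>2) ^ card (F v))"
  have finA: "finite (A i)" if "i \<le> r" for i
    using A[OF that] assms(1) finite_subset by blast
  have finI: "finite I"
    unfolding I_def using finA by (intro finite_PiE) auto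
  have cardI: "card I = k ^ (r + 1)"
    unfolding I_def using A by (simp add: card_PiE)
  have inj: "inj_on v {..r}" if "v \<in> I" for v
    using that disj unfolding I_def by (intro inj_onI) (metis PiE_mem atMost_iff disjoint_iff)
  have cardF: "2 * card (F v) = r * (r + 1)" if "v \<in> I" for v
    using inj[OF that] by (simp add: F_def card_image two_mult_choose_two)
  have FV: "F v \<subseteq> [V]\<^bsup>2\<^esup>" if "v \<in> I" for v
    unfolding F_def using that A by (intro nsets_mono) (fastforce simp: I_def PiE_iff)
  have b: "0 \<le> b" "b \<le> 1"
  proof -
    show "0 \<le> b" using s by (simp add: b_def)
    moreover have "(1::real) \<le> 2 ^ (r + 1)"
      by (rule one_le_power) simp
    ultimately have "1 * b \<le> 2 ^ (r + 1) * b"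
      by (rule mult_right_mono[rotated])
    with small show "b \<le> 1" by (simp add: b_def)
  qed
  \<comment> \<open>Each clique has \<open>r * (r + 1) / 2\<close> edges, each present with
    probability \<open>s^2\<close>.\<close>
  have \<mu>: "\<mu> = real k ^ (r + 1) * s ^ (r * (r + 1))"
    using cardI cardF by (simp add: \<mu>_def flip: power_mult)
  have overlap: "(\<Sum>w\<in>{w \<in> I. w \<noteq> v \<and> F v \<inter> F w \<noteq> {}}. (s\<^sup>2) ^ card (F v \<union> F w))
      \<le> 2 ^ (r + 1) * (s ^ (r * (r + 1)) * b)" if v: "v \<in> I" for v
  proof -
    define S where "S = {w \<in> I. w \<noteq> v \<and> F v \<inter> F w \<noteq> {}}"
    \<comment> \<open>Overlapping cliques are grouped by the indices at which they agree: at least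
      2, since they share an edge, and at most \<open>r\<close>, since they differ.\<close>
    define agree where "agree w = {i \<in> {..r}. w i = v i}" for w
    define \<T> where "\<T> = {T. T \<subseteq> {..r} \<and> 2 \<le> card T \<and> card T \<le> r}"
    have fin: "finite \<T>" "finite S"
      using finI by (auto simp: \<T>_def S_def intro: finite_subset[of _ "Pow {..r}"])
    have FF: "F v \<inter> F w = [v ` agree w]\<^bsup>2\<^esup>" if w: "w \<in> I" for w
    proof -
      have "v ` {..r} \<inter> w ` {..r} = v ` agree w"
      proof -
        \<comment> \<open>The sets \<open>A i\<close> are disjoint, so a common vertex sits at the
          same index in both cliques.\<close>
        have same: "i = j" if "i \<le> r" "j \<le> r" "v i = w j" for i j
        proof -
          have "v i \<in> A i" "w j \<in> A j"
            using v w that(1,2) by (simp_all add: I_def PiE_mem)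
          then show ?thesis using disj[of i j] that by auto
        qed
        show ?thesis
        proof (intro equalityI subsetI)
          fix x assume "x \<in> v ` {..r} \<inter> w ` {..r}"
          then obtain i j where "i \<le> r" "j \<le> r" "x = v i" "x = w j" by auto
          with same[of i j] show "x \<in> v ` agree w" by (auto simp: agree_def)
        qed (auto simp: agree_def intro: rev_image_eqI)
      qed
      moreover have "F v \<inter> F w = [v ` {..r} \<inter> w ` {..r}]\<^bsup>2\<^esup>"
        by (auto simp: F_def nsets_def)
      ultimately show ?thesis by simp
    qed
    have card_FF: "card (F v \<inter> F w) = card (agree w) choose 2" if w: "w \<in> I" for w
    proof -
      have "inj_on v (agree w)"
        using inj[OF v] by (rule inj_on_subset) (auto simp: agree_def)
      then show ?thesis by (simp add: FF[OF w] card_image)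
    qed
    have agree: "agree w \<in> \<T>" if w: "w \<in> S" for w
    proof -
      have "finite (F v \<inter> F w)"
        by (simp add: F_def finite_imp_finite_nsets)
      then have "card (F v \<inter> F w) \<noteq> 0"
        using w unfolding S_def by (metis (mono_tags, lifting) card_0_eq mem_Collect_eq)
      then have "card (agree w) choose 2 \<noteq> 0"
        using w card_FF[of w] by (simp add: S_def)
      then have "2 \<le> card (agree w)"
        by (metis binomial_eq_0 not_le)
      moreover have "agree w \<subset> {..r}"
      proof -
        have "w \<in> Pi\<^sub>E {..r} A" "v \<in> Pi\<^sub>E {..r} A" "w \<noteq> v"
          using w v by (simp_all add: S_def I_def)
        then have "\<exists>i\<le>r. w i \<noteq> v i"
          using PiE_ext[of w "{..r}" A v] by auto
        then show ?thesis by (auto simp: agree_def)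
      qed
      ultimately show ?thesis
        using psubset_card_mono[of "{..r}" "agree w"] by (auto simp: \<T>_def)
    qed
    have fibre: "(\<Sum>w\<in>{w \<in> S. agree w = T}. (s\<^sup>2) ^ card (F v \<union> F w)) \<le> s ^ (r * (r + 1)) * b"
      if T: "T \<in> \<T>" for T
    proof -
      \<comment> \<open>The shift by one turns twice the number of shared edges into
        \<open>(i + 1) * i\<close>; \<open>d\<close> counts the indices where \<open>w\<close> is
        still free.\<close>
      define i where "i = card T - 1"
      define d where "d = r + 1 - card T"
      have i: "card T = i + 1" "r = i + d" "1 \<le> i" "1 \<le> d"
        using T by (auto simp: \<T>_def i_def d_def)
      have summand: "(s\<^sup>2) ^ card (F v \<union> F w) = s ^ (r * (r + 1)) * (s ^ (2 * i + d + 1)) ^ d"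
        if w: "w \<in> I" "agree w = T" for w
      proof -
        have "card (F v) + card (F w) = card (F v \<union> F w) + card (F v \<inter> F w)"
          by (intro card_Un_Int) (simp_all add: F_def finite_imp_finite_nsets)
        then have "2 * card (F v \<union> F w) + 2 * (card T choose 2) = 2 * card (F v) + 2 * card (F w)"
          using card_FF[OF w(1)] w(2) by simp
        then have "2 * card (F v \<union> F w) + (i + 1) * i = 2 * (r * (r + 1))"
          using cardF[OF v] cardF[OF w(1)] by (simp add: two_mult_choose_two i(1))
        \<comment> \<open>Since \<open>r = i + d\<close>, the difference of
          \<open>r * (r + 1)\<close> and \<open>i * (i + 1)\<close> factors as
          \<open>(2 * i + d + 1) * d\<close>.\<close>
        then have "2 * card (F v \<union> F w) = r * (r + 1) + (2 * i + d + 1) * d"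
          unfolding i(2) by (simp add: algebra_simps)
        then show ?thesis
          by (simp only: power_add[of s "r * (r + 1)"] flip: power_mult)
      qed
      have "card {w \<in> I. agree w = T} \<le> card (Pi\<^sub>E {..r} (\<lambda>j. if j \<in> T then {v j} else A j))"
        using finA by (intro card_mono finite_PiE) (auto simp: I_def agree_def PiE_iff extensional_def)
      also have "\<dots> = (\<Prod>j\<in>{..r}. if j \<in> T then 1 else k)"
        using A by (subst card_PiE) (auto intro!: prod.cong)
      also have "\<dots> = k ^ card ({..r} - T)"
        by (subst prod.If_cases) (auto simp: Diff_eq)
      also have "card ({..r} - T) = d"
        using T by (subst card_Diff_subset) (auto simp: d_def \<T>_def intro: finite_subset)
      finally have "real (card {w \<in> I. agree w = T}) \<le> real (k ^ d)"
        by (rule of_nat_mono)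
      then have count: "real (card {w \<in> I. agree w = T}) \<le> real k ^ d" by simp
      have "(\<Sum>w\<in>{w \<in> S. agree w = T}. (s\<^sup>2) ^ card (F v \<union> F w))
        \<le> (\<Sum>w\<in>{w \<in> I. agree w = T}. (s\<^sup>2) ^ card (F v \<union> F w))"
        using finI by (intro sum_mono2) (auto simp: S_def)
      also have "\<dots> = real (card {w \<in> I. agree w = T}) * (s ^ (r * (r + 1)) * (s ^ (2 * i + d + 1)) ^ d)"
        using summand by simp
      also have "\<dots> \<le> real k ^ d * (s ^ (r * (r + 1)) * (s ^ (2 * i + d + 1)) ^ d)"
        using count s by (intro mult_right_mono) auto
      also have "\<dots> = s ^ (r * (r + 1)) * (real k * s ^ (2 * i + d + 1)) ^ d"
        by (simp add: power_mult_distrib)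
      \<comment> \<open>The exponent equals \<open>r + i + 1\<close>, which is at least
        \<open>r + 2\<close>, and \<open>s\<close> is at most 1. The next step uses that
        \<open>d\<close> is at least 1 and \<open>b\<close> at most 1.\<close>
      also have "(real k * s ^ (2 * i + d + 1)) ^ d \<le> b ^ d"
        unfolding b_def using s i by (intro power_mono mult_left_mono power_decreasing) auto
      also have "b ^ d \<le> b ^ 1"
        using b i by (intro power_decreasing) auto
      finally show ?thesis
        using s by (simp add: mult_left_mono)
    qed
    have "(\<Sum>w\<in>S. (s\<^sup>2) ^ card (F v \<union> F w))
      = (\<Sum>T\<in>\<T>. \<Sum>w\<in>{w \<in> S. agree w = T}. (s\<^sup>2) ^ card (F v \<union> F w))"
      using fin agree by (intro sum.group[symmetric]) auto
    also have "\<dots> \<le> real (card \<T>) * (s ^ (r * (r + 1)) * b)"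
      by (intro sum_bounded_above fibre)
    also have "\<dots> \<le> 2 ^ (r + 1) * (s ^ (r * (r + 1)) * b)"
    proof (intro mult_right_mono)
      have "card \<T> \<le> card (Pow {..r})"
        by (intro card_mono) (auto simp: \<T>_def)
      also have "\<dots> = 2 ^ (r + 1)"
        by (simp add: card_Pow)
      finally have "real (card \<T>) \<le> real (2 ^ (r + 1))"
        by (rule of_nat_mono)
      then show "real (card \<T>) \<le> 2 ^ (r + 1)" by simp
    qed (use s b in auto)
    finally show ?thesis by (simp add: S_def)
  qed
  have "measure_pmf.expectation (bernoulli_product ([V]\<^bsup>2\<^esup>) (s\<^sup>2))
      (\<lambda>X. of_bool (\<forall>v\<in>I. \<not> (\<forall>e\<in>F v. X e)))
    \<le> exp (- \<mu> + (\<Sum>v\<in>I. \<Sum>w\<in>{w \<in> I. w \<noteq> v \<and> F v \<inter> F w \<noteq> {}}. (s\<^sup>2) ^ card (F v \<union> F w)))"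
    unfolding \<mu>_def using assms(1) s finI FV
    by (intro janson_inequality) (auto simp: finite_imp_finite_nsets power_le_one)
  also have "\<dots> \<le> exp (- \<mu> / 2)"
  proof -
    have "(\<Sum>v\<in>I. \<Sum>w\<in>{w \<in> I. w \<noteq> v \<and> F v \<inter> F w \<noteq> {}}. (s\<^sup>2) ^ card (F v \<union> F w))
      \<le> real (card I) * (2 ^ (r + 1) * (s ^ (r * (r + 1)) * b))"
      by (intro sum_bounded_above overlap)
    also have "\<dots> = \<mu> * (2 ^ (r + 1) * b)"
      by (simp add: cardI \<mu>)
    also have "\<dots> \<le> \<mu> * (1 / 2)"
      using small s by (intro mult_left_mono) (auto simp: b_def \<mu>)
    finally show ?thesis by simp
  qed
  also have "\<mu> = real k * (real k * s ^ (r + 1)) ^ r"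
    by (simp add: \<mu> power_mult_distrib power_add mult.commute flip: power_mult)
  finally show ?thesis by (simp add: I_def F_def)
qed


text \<open>A union bound: each of the \<open>r + 1\<close> sets is one of \<open>2 ^ card V\<close>
  subsets. Missing all transversal cliques is an antimonotone event, so \<open>q\<close> may be
  lowered to \<open>s^2\<close> first.\<close>

lemma prob_some_transversal_clique_missing:
  fixes s q :: real
  assumes "finite V" "0 \<le> s" "s\<^sup>2 \<le> q" "q \<le> 1" "2 ^ (r + 1) * (real k * s ^ (r + 2)) \<le> 1 / 2"
  shows "measure_pmf.prob (bernoulli_product ([V]\<^bsup>2\<^esup>) q)
      {X. \<exists>A. (\<forall>i\<le>r. A i \<subseteq> V \<and> card (A i) = k) \<and> (\<forall>i\<le>r. \<forall>j\<le>r. i \<noteq> j \<longrightarrow> A i \<inter> A j = {}) \<and>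
        (\<forall>v\<in>Pi\<^sub>E {..r} A. \<not> (\<forall>e\<in>[v ` {..r}]\<^bsup>2\<^esup>. X e))}
    \<le> 2 ^ (card V * (r + 1)) * exp (- (real k * (real k * s ^ (r + 1)) ^ r) / 2)"
proof -
  let ?M = "bernoulli_product ([V]\<^bsup>2\<^esup>) q"
  define missing where "missing A = {X. \<forall>v\<in>Pi\<^sub>E {..r} A. \<not> (\<forall>e\<in>[v ` {..r}]\<^bsup>2\<^esup>. X e)}"
    for A :: "nat \<Rightarrow> 'a set"
  define \<A> where "\<A> = {A \<in> {..r} \<rightarrow>\<^sub>E Pow V. (\<forall>i\<le>r. A i \<subseteq> V \<and> card (A i) = k) \<and>
    (\<forall>i\<le>r. \<forall>j\<le>r. i \<noteq> j \<longrightarrow> A i \<inter> A j = {})}"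
  have fin: "finite ({..r} \<rightarrow>\<^sub>E Pow V)"
    using assms(1) by (intro finite_PiE) auto
  then have fin\<A>: "finite \<A>" by (simp add: \<A>_def)
  have "card \<A> \<le> card ({..r} \<rightarrow>\<^sub>E Pow V)"
    using fin by (intro card_mono) (auto simp: \<A>_def)
  also have "\<dots> = (2 ^ card V) ^ (r + 1)"
    using assms(1) by (simp add: card_PiE card_Pow)
  also have "\<dots> = 2 ^ (card V * (r + 1))"
    by (simp only: power_mult)
  finally have "real (card \<A>) \<le> real (2 ^ (card V * (r + 1)))"
    by (rule of_nat_mono)
  then have card: "real (card \<A>) \<le> 2 ^ (card V * (r + 1))" by simp
  have "s \<le> 1"
    using assms(2-4) by (metis abs_of_nonneg abs_square_le_1 order_trans)
  have prob: "measure_pmf.prob ?M (missing A) \<le> exp (- (real k * (real k * s ^ (r + 1)) ^ r) / 2)"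
    if "A \<in> \<A>" for A
  proof -
    let ?f = "\<lambda>X. of_bool (\<forall>v\<in>Pi\<^sub>E {..r} A. \<not> (\<forall>e\<in>[v ` {..r}]\<^bsup>2\<^esup>. X e)) :: real"
    have "measure_pmf.prob ?M (missing A) = measure_pmf.expectation ?M (indicator (missing A))"
      by simp
    also have "indicator (missing A) = ?f"
      by (auto simp: missing_def indicator_def fun_eq_iff)
    also have "measure_pmf.expectation ?M ?f
        \<le> measure_pmf.expectation (bernoulli_product ([V]\<^bsup>2\<^esup>) (s\<^sup>2)) ?f"
    proof (rule expectation_bernoulli_product_antimono)
      show "antimono ?f"
        by (intro antimonoI) (force simp: le_fun_def)
    qed (use assms in \<open>auto simp: finite_imp_finite_nsets\<close>)
    also have "\<dots> \<le> exp (- (real k * (real k * s ^ (r + 1)) ^ r) / 2)"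
      using that assms \<open>s \<le> 1\<close> by (intro transversal_clique_missing_bound) (auto simp: \<A>_def)
    finally show ?thesis .
  qed
  have "{X. \<exists>A. (\<forall>i\<le>r. A i \<subseteq> V \<and> card (A i) = k) \<and> (\<forall>i\<le>r. \<forall>j\<le>r. i \<noteq> j \<longrightarrow> A i \<inter> A j = {}) \<and>
      (\<forall>v\<in>Pi\<^sub>E {..r} A. \<not> (\<forall>e\<in>[v ` {..r}]\<^bsup>2\<^esup>. X e))} \<subseteq> (\<Union>A\<in>\<A>. missing A)"
  proof safe
    fix X A
    assume A: "\<forall>i\<le>r. A i \<subseteq> V \<and> card (A i) = k" "\<forall>i\<le>r. \<forall>j\<le>r. i \<noteq> j \<longrightarrow> A i \<inter> A j = {}"
      and "\<forall>v\<in>Pi\<^sub>E {..r} A. \<not> (\<forall>e\<in>[v ` {..r}]\<^bsup>2\<^esup>. X e)"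
    \<comment> \<open>Values of \<open>A\<close> outside \<open>{..r}\<close> are arbitrary;
      restricting them leaves the transversals unchanged and puts the family into the finite set of
      extensional functions.\<close>
    moreover have "Pi\<^sub>E {..r} (restrict A {..r}) = Pi\<^sub>E {..r} A"
      by (intro PiE_cong) auto
    ultimately have "restrict A {..r} \<in> \<A>" "X \<in> missing (restrict A {..r})"
      by (auto simp: \<A>_def missing_def)
    then show "X \<in> (\<Union>A\<in>\<A>. missing A)" by blast
  qed
  then have "measure_pmf.prob ?M {X. \<exists>A. (\<forall>i\<le>r. A i \<subseteq> V \<and> card (A i) = k) \<and>
      (\<forall>i\<le>r. \<forall>j\<le>r. i \<noteq> j \<longrightarrow> A i \<inter> A j = {}) \<and> (\<forall>v\<in>Pi\<^sub>E {..r} A. \<not> (\<forall>e\<in>[v ` {..r}]\<^bsup>2\<^esup>. X e))}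
    \<le> measure_pmf.prob ?M (\<Union>A\<in>\<A>. missing A)"
    by (intro measure_pmf.finite_measure_mono) auto
  also have "\<dots> \<le> (\<Sum>A\<in>\<A>. measure_pmf.prob ?M (missing A))"
    using fin\<A> by (intro measure_pmf.finite_measure_subadditive_finite) auto
  also have "\<dots> \<le> real (card \<A>) * exp (- (real k * (real k * s ^ (r + 1)) ^ r) / 2)"
    by (intro sum_bounded_above prob)
  also have "\<dots> \<le> 2 ^ (card V * (r + 1)) * exp (- (real k * (real k * s ^ (r + 1)) ^ r) / 2)"
    using card by (intro mult_right_mono) auto
  finally show ?thesis .
qed

text \<open>Outside \<open>bad\<close> every family of sets has a transversal clique, so the
  deterministic reduction applies to the sampled graph.\<close>

lemma prob_ramsey_arrow_ge:
  fixes s q :: real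
  assumes "r * (n + k) + k \<le> N" "0 \<le> s" "s\<^sup>2 \<le> q" "q \<le> 1"
    "2 ^ (r + 1) * (real k * s ^ (r + 2)) \<le> 1 / 2"
  shows "1 - 2 ^ (N * (r + 1)) * exp (- (real k * (real k * s ^ (r + 1)) ^ r) / 2)
    \<le> measure_pmf.prob (erdos_renyi N q)
        {G. ramsey_arrow G (complete_ugraph (r + 1)) (path_ugraph n)}"
proof -
  let ?M = "bernoulli_product ([{..<N}]\<^bsup>2\<^esup>) q"
  let ?graph = "\<lambda>X. ({..<N}, {e \<in> [{..<N}]\<^bsup>2\<^esup>. X e})"
  define bad where "bad = {X. \<exists>A. (\<forall>i\<le>r. A i \<subseteq> {..<N} \<and> card (A i) = k) \<and>
    (\<forall>i\<le>r. \<forall>j\<le>r. i \<noteq> j \<longrightarrow> A i \<inter> A j = {}) \<and>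
    (\<forall>v\<in>Pi\<^sub>E {..r} A. \<not> (\<forall>e\<in>[v ` {..r}]\<^bsup>2\<^esup>. X e))}"
  have "measure_pmf.prob ?M bad
    \<le> 2 ^ (card {..<N} * (r + 1)) * exp (- (real k * (real k * s ^ (r + 1)) ^ r) / 2)"
    unfolding bad_def using assms by (intro prob_some_transversal_clique_missing finite_lessThan)
  moreover have "measure_pmf.prob ?M (UNIV - bad) = 1 - measure_pmf.prob ?M bad"
    using measure_pmf.prob_compl[of bad ?M] by (simp only: space_measure_pmf sets_measure_pmf UNIV_I)
  moreover have "UNIV - bad \<subseteq> ?graph -` {G. ramsey_arrow G (complete_ugraph (r + 1)) (path_ugraph n)}"
  proof
    fix X assume X: "X \<in> UNIV - bad"
    have "ramsey_arrow (?graph X) (complete_ugraph (r + 1)) (path_ugraph n)"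
    proof (rule ramsey_arrow_if_transversal_cliques[where k = k])
      fix A :: "nat \<Rightarrow> nat set"
      assume A: "\<And>i. i \<le> r \<Longrightarrow> A i \<subseteq> {..<N} \<and> card (A i) = k"
        "\<And>i j. i \<le> r \<Longrightarrow> j \<le> r \<Longrightarrow> i \<noteq> j \<Longrightarrow> A i \<inter> A j = {}"
      show "\<exists>v\<in>Pi\<^sub>E {..r} A. [v ` {..r}]\<^bsup>2\<^esup> \<subseteq> {e \<in> [{..<N}]\<^bsup>2\<^esup>. X e}"
      proof (rule ccontr)
        assume no_clique: "\<not> ?thesis"
        have "\<not> (\<forall>e\<in>[v ` {..r}]\<^bsup>2\<^esup>. X e)" if v: "v \<in> Pi\<^sub>E {..r} A" for v
        proof
          assume "\<forall>e\<in>[v ` {..r}]\<^bsup>2\<^esup>. X e"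
          moreover have "v ` {..r} \<subseteq> {..<N}"
            using PiE_mem[OF v] A(1) by blast
          then have "[v ` {..r}]\<^bsup>2\<^esup> \<subseteq> [{..<N}]\<^bsup>2\<^esup>" by (rule nsets_mono)
          ultimately have "[v ` {..r}]\<^bsup>2\<^esup> \<subseteq> {e \<in> [{..<N}]\<^bsup>2\<^esup>. X e}" by blast
          with no_clique v show False by blast
        qed
        then have "X \<in> bad"
          unfolding bad_def using A by (intro CollectI exI[of _ A] conjI) simp_all
        with X show False by simp
      qed
    qed (use assms(1) in auto)
    then show "X \<in> ?graph -` {G. ramsey_arrow G (complete_ugraph (r + 1)) (path_ugraph n)}"
      by simp
  qed
  then have "measure_pmf.prob ?M (UNIV - bad)
      \<le> measure_pmf.prob ?M (?graph -` {G. ramsey_arrow G (complete_ugraph (r + 1)) (path_ugraph n)})"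
    by (intro measure_pmf.finite_measure_mono) auto
  ultimately show ?thesis
    unfolding erdos_renyi_def measure_map_pmf card_lessThan by linarith
qed

section \<open>Choice of parameters and passage to the limit\<close>

theorem theorem1p1:
  fixes r :: nat and p :: "nat \<Rightarrow> real" and \<epsilon> :: real
  assumes "r \<ge> 2"
    and "\<And>n. p n \<in> {0<..<1}"
    and "filterlim (\<lambda>n. p n / real n powr (- 2 / (real r + 1))) at_top sequentially"
    and "\<epsilon> > 0"
  shows "(\<lambda>n. measure_pmf.prob (erdos_renyi (nat \<lfloor>(1 + \<epsilon>) * real r * real n\<rfloor>) (p n))
            {G. ramsey_arrow G (complete_ugraph (r + 1)) (path_ugraph n)}) \<longlonglongrightarrow> 1"
proof -
  define N where "N n = nat \<lfloor>(1 + \<epsilon>) * real r * real n\<rfloor>" for n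
  define k where "k n = nat \<lfloor>\<epsilon> * real n / 2\<rfloor>" for n
  \<comment> \<open>The number of families is at most \<open>exp (c * n)\<close>. The choice of
    \<open>L\<close> gives \<open>k n * L ^ r / 2\<close> at least \<open>(c + 1) * n\<close>
    eventually, and the maximum with 1 ensures that \<open>L ^ r\<close> is at least
    \<open>L\<close>.\<close>
  define c where "c = (1 + \<epsilon>) * real r * (real r + 1)"
  define L where "L = max 1 (8 * (c + 1) / \<epsilon>)"
  \<comment> \<open>Chosen so that \<open>k n * s n ^ (r + 1) = L\<close>; then
    \<open>(s n)^2\<close> is eventually at most a constant multiple of the threshold and so falls
    below \<open>p n\<close>.\<close>
  define s where "s n = (L / k n) powr (1 / (real r + 1))" for n
  have L: "1 \<le> L" "c + 1 \<le> \<epsilon> * L / 8"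
    using assms(4) by (auto simp: L_def field_simps max_def)
  have k_le: "real (k n) \<le> \<epsilon> * n / 2" for n
    using assms(4) unfolding k_def by (intro of_nat_floor) simp
  have k_ge: "eventually (\<lambda>n. \<epsilon> * real n / 4 \<le> real (k n)) sequentially"
  proof -
    have "eventually (\<lambda>n. \<epsilon> * real n / 4 \<le> \<epsilon> * real n / 2 - 1) sequentially"
      using assms(4) by real_asymp
    then show ?thesis
    proof eventually_elim
      case (elim n)
      have "\<epsilon> * real n / 2 - 1 \<le> real (k n)"
        using assms(4) unfolding k_def by linarith
      with elim show ?case by linarith
    qed
  qed
  have sizes: "eventually (\<lambda>n. r * (n + k n) + k n \<le> N n) sequentially"
  proof -
    have "eventually (\<lambda>n. 1 \<le> \<epsilon> * real r * real n / 4) sequentially"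
      using assms(1,4) by real_asymp
    then show ?thesis
    proof eventually_elim
      case (elim n)
      \<comment> \<open>As \<open>r\<close> is at least 2, \<open>r + 1\<close> is at most
        \<open>3 / 2 * r\<close>. The sets thus use up to three quarters of the surplus
        \<open>\<epsilon> * r * n\<close>, and the remaining quarter absorbs the rounding in
        \<open>N n\<close>.\<close>
      have "(real r + 1) * real (k n) \<le> (3 / 2 * real r) * (\<epsilon> * n / 2)"
        using assms(1) k_le by (intro mult_mono) auto
      then have "real (r * (n + k n) + k n) \<le> (1 + \<epsilon>) * real r * real n - 1"
        using elim by (simp add: algebra_simps)
      also have "\<dots> \<le> real (N n)"
        unfolding N_def by linarith
      finally show ?case by linarith
    qed
  qed
  have k_top: "filterlim (\<lambda>n. real (k n)) at_top sequentially"
  proof (rule filterlim_at_top_mono[OF _ k_ge])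
    show "filterlim (\<lambda>n. \<epsilon> * real n / 4) at_top sequentially"
      using assms(4) by real_asymp
  qed
  have k_pos: "eventually (\<lambda>n. 0 < real (k n)) sequentially"
    using k_top unfolding filterlim_at_top_dense by blast
  have s_pow: "s n ^ (r + 1) = L / k n" if "0 < k n" for n
  proof -
    have "s n ^ (r + 1) = (L / k n) powr (real (r + 1) * (1 / (real r + 1)))"
      unfolding s_def using L that by (intro powr_power) simp
    also have "real (r + 1) * (1 / (real r + 1)) = 1"
      by (simp add: field_simps)
    finally show ?thesis using L by simp
  qed
  have "s \<longlonglongrightarrow> 0"
  proof -
    have "(\<lambda>n. L / real (k n)) \<longlonglongrightarrow> 0"
      using tendsto_divide_0[OF tendsto_const filterlim_at_top_imp_at_infinity[OF k_top]] .
    then have "(\<lambda>n. (L / real (k n)) powr (1 / (real r + 1))) \<longlonglongrightarrow> 0 powr (1 / (real r + 1))"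
      using L by (intro tendsto_powr' tendsto_const) auto
    then show ?thesis by (simp add: s_def[abs_def])
  qed
  then have "(\<lambda>n. 2 ^ (r + 1) * (L * s n)) \<longlonglongrightarrow> 2 ^ (r + 1) * (L * 0)"
    by (intro tendsto_intros)
  then have "eventually (\<lambda>n. 2 ^ (r + 1) * (L * s n) < 1 / 2) sequentially"
    by (rule order_tendstoD) simp
  then have small: "eventually (\<lambda>n. 2 ^ (r + 1) * (real (k n) * s n ^ (r + 2)) \<le> 1 / 2) sequentially"
    using k_pos
  proof eventually_elim
    case (elim n)
    \<comment> \<open>One power of \<open>s n\<close> is left over after
      \<open>k n * s n ^ (r + 1) = L\<close>, and it tends to 0.\<close>
    have "real (k n) * s n ^ (r + 2) = (real (k n) * s n ^ (r + 1)) * s n" by simp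
    also have "real (k n) * s n ^ (r + 1) = L"
      unfolding s_pow[OF elim(2)[unfolded of_nat_0_less_iff]] using elim(2) by simp
    finally have eq: "real (k n) * s n ^ (r + 2) = L * s n" .
    show ?case
      unfolding eq using elim(1) by (rule less_imp_le)
  qed
  have s_le_p: "eventually (\<lambda>n. (s n)\<^sup>2 \<le> p n) sequentially"
  proof -
    define \<alpha> where "\<alpha> = 2 / (real r + 1)"
    have "eventually (\<lambda>n. (4 * L / \<epsilon>) powr \<alpha> \<le> p n / real n powr (- 2 / (real r + 1))) sequentially"
      using assms(3) by (simp add: filterlim_at_top)
    then show ?thesis
      using k_ge k_pos eventually_gt_at_top[of 0]
    proof eventually_elim
      case (elim n)
      have "(s n)\<^sup>2 = (L / k n) powr \<alpha>"
        using elim L by (simp add: s_def \<alpha>_def powr_power)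
      also have "\<dots> \<le> (4 * L / \<epsilon> / n) powr \<alpha>"
      proof (rule powr_mono2)
        have "L / real (k n) \<le> L / (\<epsilon> * real n / 4)"
          using elim L assms(4) by (intro divide_left_mono) auto
        then show "L / real (k n) \<le> 4 * L / \<epsilon> / n" by (simp add: field_simps)
      qed (use L in \<open>auto simp: \<alpha>_def\<close>)
      also have "\<dots> = (4 * L / \<epsilon>) powr \<alpha> * real n powr (- \<alpha>)"
        by (subst powr_divide) (use L assms(4) in \<open>auto simp: powr_minus_divide\<close>)
      also have "\<dots> \<le> p n"
        using elim(1,4) by (simp add: \<alpha>_def field_simps)
      finally show ?case .
    qed
  qed
  have lower: "eventually (\<lambda>n. 1 - exp (- real n) \<le> measure_pmf.prob (erdos_renyi (N n) (p n))
      {G. ramsey_arrow G (complete_ugraph (r + 1)) (path_ugraph n)}) sequentially"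
    using sizes small s_le_p k_ge k_pos
  proof eventually_elim
    case (elim n)
    have "2 ^ (N n * (r + 1)) \<le> exp (1 :: real) ^ (N n * (r + 1))"
      using exp_ge_add_one_self[of 1] by (intro power_mono) auto
    also have "\<dots> = exp (real (N n) * (real r + 1))"
      using exp_of_nat_mult[of "N n * (r + 1)" "1 :: real"] by (simp add: algebra_simps)
    also have "\<dots> \<le> exp (c * n)"
    proof -
      have "real (N n) \<le> (1 + \<epsilon>) * real r * real n"
        using assms(4) unfolding N_def by (intro of_nat_floor) simp
      then have "real (N n) * (real r + 1) \<le> (1 + \<epsilon>) * real r * real n * (real r + 1)"
        by (intro mult_right_mono) auto
      then show ?thesis by (simp add: c_def algebra_simps)
    qed
    finally have "2 ^ (N n * (r + 1)) * exp (- (real (k n) * (real (k n) * s n ^ (r + 1)) ^ r) / 2)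
      \<le> exp (c * n) * exp (- (real (k n) * (real (k n) * s n ^ (r + 1)) ^ r) / 2)"
      by (intro mult_right_mono) auto
    also have "\<dots> = exp (c * n - real (k n) * L ^ r / 2)"
      using elim(5) s_pow[of n] by (simp flip: exp_add)
    also have "\<dots> \<le> exp (- real n)"
    proof -
      \<comment> \<open>Half of \<open>k n * L ^ r\<close> is at least
        \<open>\<epsilon> * L / 8 * n\<close>, which covers both \<open>c * n\<close> and the target
        \<open>n\<close>.\<close>
      have "L ^ 1 \<le> L ^ r"
        using L assms(1) by (intro power_increasing) auto
      then have "(\<epsilon> * real n / 4) * L \<le> real (k n) * L ^ r"
        using elim(4) L assms(4) by (intro mult_mono) auto
      moreover have "(c + 1) * n \<le> \<epsilon> * L / 8 * n"
        using L by (intro mult_right_mono) auto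
      ultimately show ?thesis by (simp add: algebra_simps)
    qed
    finally have bound: "2 ^ (N n * (r + 1)) * exp (- (real (k n) * (real (k n) * s n ^ (r + 1)) ^ r) / 2)
      \<le> exp (- real n)" .
    have s_nonneg: "0 \<le> s n" by (simp add: s_def)
    have p_le: "p n \<le> 1" using assms(2)[of n] by simp
    show ?case
      using bound prob_ramsey_arrow_ge[OF elim(1) s_nonneg elim(3) p_le elim(2)]
      by linarith
  qed
  have "(\<lambda>n. 1 - exp (- real n)) \<longlonglongrightarrow> 1"
    by real_asymp
  then show ?thesis
    using tendsto_sandwich[OF lower _ _ tendsto_const] unfolding N_def by simp
qed

end
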